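(* For all $a>0$ and $b>0$, the unique equilibrium point $P_a=\left(\tfrac a5,\,1+\tfrac{a^2}{25}\right)$ of the planar differential system $$\dot x=(a-x)(1+x^2)-4xy,\qquad \dot y=b x\,(1+x^2-y),\qquad (x,y)\in\mathbb{R}^2,$$ is not globally (asymptotically) stable.
   Context: An equilibrium point of a planar vector field is globally (asymptotically) stable if it is a global attractor, i.e. it is asymptotically stable and its basin of attraction (the set of initial conditions whose forward solution is defined for all $t\ge0$ and converges to the equilibrium as $t\to\infty$) is the whole plane $\mathbb{R}^2$. *)

theory Defs imports "HOL-Analysis.Analysis" begin

definition equilibrium :: "('a::real_normed_vector \<Rightarrow> 'a) \<Rightarrow> 'a \<Rightarrow> bool" where
  "equilibrium F p \<longleftrightarrow> F p = 0"

(* At endpoints of I belonging to I, the derivative is one-sided. *)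
definition solution_on :: "('a::real_normed_vector \<Rightarrow> 'a) \<Rightarrow> real set \<Rightarrow> (real \<Rightarrow> 'a) \<Rightarrow> bool" where
  "solution_on F I \<phi> \<longleftrightarrow> (\<forall>t\<in>I. (\<phi> has_vector_derivative F (\<phi> t)) (at t within I))"

(* Meant for vector fields with uniqueness of solutions (e.g. locally Lipschitz ones),
   for which the witness is the forward solution through z. *)
definition basin_of_attraction :: "('a::real_normed_vector \<Rightarrow> 'a) \<Rightarrow> 'a \<Rightarrow> 'a set" where
  "basin_of_attraction F p =
    {z. \<exists>\<phi>. \<phi> 0 = z \<and> solution_on F {0..} \<phi> \<and> (\<phi> \<longlongrightarrow> p) at_top}"

(* Quantifying over all compact time intervals covers every forward solution,
   whether or not it is defined for all positive times. *)
definition lyapunov_stable :: "('a::real_normed_vector \<Rightarrow> 'a) \<Rightarrow> 'a \<Rightarrow> bool" where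
  "lyapunov_stable F p \<longleftrightarrow>
    (\<forall>\<epsilon>>0. \<exists>\<delta>>0. \<forall>T\<ge>0. \<forall>\<phi>. solution_on F {0..T} \<phi> \<and> dist (\<phi> 0) p < \<delta>
        \<longrightarrow> (\<forall>t\<in>{0..T}. dist (\<phi> t) p < \<epsilon>))"

definition asymptotically_stable :: "('a::real_normed_vector \<Rightarrow> 'a) \<Rightarrow> 'a \<Rightarrow> bool" where
  "asymptotically_stable F p \<longleftrightarrow>
    lyapunov_stable F p \<and> (\<exists>\<delta>>0. ball p \<delta> \<subseteq> basin_of_attraction F p)"

definition globally_asymptotically_stable :: "('a::real_normed_vector \<Rightarrow> 'a) \<Rightarrow> 'a \<Rightarrow> bool" where
  "globally_asymptotically_stable F p \<longleftrightarrow>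
    asymptotically_stable F p \<and> basin_of_attraction F p = UNIV"

definition planar_field :: "real \<Rightarrow> real \<Rightarrow> real \<times> real \<Rightarrow> real \<times> real" where
  "planar_field a b = (\<lambda>(x, y). ((a - x) * (1 + x\<^sup>2) - 4 * x * y, b * x * (1 + x\<^sup>2 - y)))"

end

theory Submission imports Defs begin

text \<open>
  The quadrant \<open>x < -1\<close>, \<open>y < -(a + 1)\<close> is positively invariant: in it \<open>y\<close> decreases, and on its
  side \<open>x = -1\<close> we have \<open>x' = 2 (a + 1) + 4 y < 0\<close>. A solution starting there never
  approaches the equilibrium, whose first coordinate is positive.
\<close>

lemma equilibrium_planar_field_iff:
  assumes "a > 0" and "b > 0"
  shows "equilibrium (planar_field a b) p \<longleftrightarrow> p = (a / 5, 1 + a\<^sup>2 / 25)"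
proof -
  obtain x y where p: "p = (x, y)" by (cases p)
  have "equilibrium (planar_field a b) p \<longleftrightarrow>
      (a - x) * (1 + x\<^sup>2) - 4 * x * y = 0 \<and> (x = 0 \<or> y = 1 + x\<^sup>2)"
    using \<open>b > 0\<close> by (auto simp: equilibrium_def planar_field_def p zero_prod_def)
  \<comment> \<open>At \<open>x = 0\<close> the first equation reduces to \<open>a = 0\<close>, so
    positivity of \<open>a\<close> leaves only the branch on the parabola.\<close>
  also have "\<dots> \<longleftrightarrow> (a - x) * (1 + x\<^sup>2) - 4 * x * (1 + x\<^sup>2) = 0 \<and> y = 1 + x\<^sup>2"
    using \<open>a > 0\<close> by auto
  also have "(a - x) * (1 + x\<^sup>2) - 4 * x * (1 + x\<^sup>2) = (a - 5 * x) * (1 + x\<^sup>2)"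
    by (simp add: algebra_simps)
  also have "(a - 5 * x) * (1 + x\<^sup>2) = 0 \<longleftrightarrow> x = a / 5"
    using sum_power2_eq_zero_iff[of 1 x] by auto
  finally show ?thesis
    by (auto simp: p power_divide)
qed

text \<open>First-exit argument: at the first time outside the quadrant, monotonicity of
  \<open>y\<close> rules out the horizontal side, and the sign of \<open>x'\<close> on the vertical
  side rules out that one.\<close>

lemma planar_field_quadrant_invariant:
  assumes "a > 0" and "b > 0"
    and sol: "solution_on (planar_field a b) {0..} \<phi>"
    and x0: "fst (\<phi> 0) < -1" and y0: "snd (\<phi> 0) < -(a + 1)"
    and "t \<ge> 0"
  shows "fst (\<phi> t) < -1 \<and> snd (\<phi> t) < -(a + 1)"
proof (rule ccontr)
  assume escape: "\<not> ?thesis"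
  define x where "x = (\<lambda>t. fst (\<phi> t))"
  define y where "y = (\<lambda>t. snd (\<phi> t))"
  have d\<phi>: "(\<phi> has_vector_derivative planar_field a b (x s, y s)) (at s within {0..})"
    if "s \<ge> 0" for s
    using sol that by (simp add: solution_on_def x_def y_def)
  have dx: "(x has_real_derivative (a - x s) * (1 + (x s)\<^sup>2) - 4 * x s * y s) (at s within {0..})"
    and dy: "(y has_real_derivative b * x s * (1 + (x s)\<^sup>2 - y s)) (at s within {0..})"
    if "s \<ge> 0" for s
    using bounded_linear.has_vector_derivative[OF bounded_linear_fst d\<phi>[OF that]]
      bounded_linear.has_vector_derivative[OF bounded_linear_snd d\<phi>[OF that]]
    by (simp_all add: planar_field_def case_prod_beta has_real_derivative_iff_has_vector_derivative x_def y_def)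
  have cx: "continuous_on {0..} x" and cy: "continuous_on {0..} y"
    using dx dy by (auto intro!: DERIV_continuous_on)
  \<comment> \<open>The times spent outside the open quadrant. As \<open>S\<close> is closed, its
    infimum is attained and is the first exit time.\<close>
  define S where "S = {s \<in> {0..}. x s \<ge> -1} \<union> {s \<in> {0..}. y s \<ge> -(a + 1)}"
  have "closed S"
    unfolding S_def using cx cy
    by (intro closed_Un continuous_on_closed_Collect_le) auto
  moreover have "t \<in> S"
    using escape \<open>t \<ge> 0\<close> by (auto simp: S_def x_def y_def)
  moreover have bdd: "bdd_below S"
    by (auto simp: S_def intro: bdd_belowI[of _ 0])
  ultimately have "Inf S \<in> S"
    by (metis closed_contains_Inf empty_iff)
  define T where "T = Inf S"
  have T: "T \<in> S" "T \<ge> 0"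
    using \<open>Inf S \<in> S\<close> by (auto simp: T_def S_def)
  have before: "x s < -1 \<and> y s < -(a + 1)" if "0 \<le> s" "s < T" for s
    using that cInf_lower[OF _ bdd, of s] unfolding T_def
    by (force simp: S_def)
  have "T \<noteq> 0"
    using T x0 y0 by (auto simp: S_def x_def y_def)
  with T have "T > 0" by simp
  \<comment> \<open>Before \<open>T\<close> both coordinates are negative, so \<open>y'\<close> is a
    negative factor \<open>b * x\<close> times a positive one. Hence the exit must occur through
    \<open>x = -1\<close>.\<close>
  have "y T < y 0"
  proof (rule DERIV_neg_imp_decreasing_open[OF \<open>T > 0\<close>])
    fix s assume s: "0 < s" "s < T"
    have "(y has_real_derivative b * x s * (1 + (x s)\<^sup>2 - y s)) (at s)"
      using dy[of s] s at_within_interior[of s "{0..}"] by simp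
    moreover have "b * x s < 0" and "1 + (x s)\<^sup>2 - y s > 0"
      using before[of s] s \<open>a > 0\<close> \<open>b > 0\<close>
      by (auto simp: mult_pos_neg intro: less_le_trans[of _ 0])
    ultimately show "\<exists>d. (y has_real_derivative d) (at s) \<and> d < 0"
      using mult_neg_pos by blast
  qed (rule continuous_on_subset[OF cy], simp)
  then have yT: "y T < -(a + 1)"
    using y0 by (simp add: y_def)
  then have "x T \<ge> -1"
    using T by (auto simp: S_def)
  moreover have "x T \<le> -1"
  proof (rule tendsto_upperbound)
    show "(x \<longlongrightarrow> x T) (at_left T)"
      using cx \<open>T > 0\<close> by (metis at_within_interior atLeast_iff continuous_on_def
          filterlim_at_split interior_real_atLeast greaterThan_iff less_imp_le)
    show "eventually (\<lambda>s. x s \<le> -1) (at_left T)"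
      using eventually_at_left_real[OF \<open>T > 0\<close>]
      by (rule eventually_mono) (simp add: before[THEN conjunct1, THEN less_imp_le])
  qed simp
  ultimately have xT: "x T = -1" by simp
  \<comment> \<open>At \<open>x T = -1\<close> this is \<open>2 * (a + 1) + 4 * y T\<close>, which
    the bound on \<open>y T\<close> makes negative. So \<open>x\<close> exceeds -1 just before
    \<open>T\<close>, against the choice of \<open>T\<close>.\<close>
  have "(a - x T) * (1 + (x T)\<^sup>2) - 4 * x T * y T < 0"
    using yT \<open>a > 0\<close> by (simp add: xT)
  from has_real_derivative_neg_dec_left[OF dx[OF \<open>T \<ge> 0\<close>] this]
  obtain d where "d > 0" and d: "\<And>h. h > 0 \<Longrightarrow> T - h \<in> {0..} \<Longrightarrow> h < d \<Longrightarrow> x T < x (T - h)"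
    by blast
  \<comment> \<open>Halving \<open>d\<close> gives the strict bound \<open>h < d\<close>; the cap
    \<open>T\<close> keeps \<open>T - h\<close> in the domain of the solution.\<close>
  define h where "h = min (d / 2) T"
  have "h > 0" "h < d" "h \<le> T"
    using \<open>d > 0\<close> \<open>T > 0\<close> by (auto simp: h_def)
  with d[of h] before[of "T - h"] xT show False by simp
qed

theorem corollary1:
  fixes a b :: real
  assumes "a > 0" and "b > 0"
  shows "(\<forall>p. equilibrium (planar_field a b) p \<longleftrightarrow> p = (a / 5, 1 + a\<^sup>2 / 25)) \<and>
         \<not> globally_asymptotically_stable (planar_field a b) (a / 5, 1 + a\<^sup>2 / 25)"
proof
  show "\<forall>p. equilibrium (planar_field a b) p \<longleftrightarrow> p = (a / 5, 1 + a\<^sup>2 / 25)"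
    using equilibrium_planar_field_iff[OF assms] by blast
  show "\<not> globally_asymptotically_stable (planar_field a b) (a / 5, 1 + a\<^sup>2 / 25)"
  proof
    assume "globally_asymptotically_stable (planar_field a b) (a / 5, 1 + a\<^sup>2 / 25)"
    \<comment> \<open>Any point of the open quadrant would serve as the starting point.\<close>
    then have "(-2, -(a + 2)) \<in> basin_of_attraction (planar_field a b) (a / 5, 1 + a\<^sup>2 / 25)"
      by (simp add: globally_asymptotically_stable_def)
    then obtain \<phi> where \<phi>: "\<phi> 0 = (-2, -(a + 2))" "solution_on (planar_field a b) {0..} \<phi>"
      and lim: "(\<phi> \<longlongrightarrow> (a / 5, 1 + a\<^sup>2 / 25)) at_top"
      by (auto simp: basin_of_attraction_def)
    \<comment> \<open>The strict bound is weakened to the form that passes to the limit.\<close>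
    have "fst (\<phi> t) \<le> -1" if "t \<ge> 0" for t
      using planar_field_quadrant_invariant[OF assms \<phi>(2) _ _ that] \<phi>(1) by simp
    then have "eventually (\<lambda>t. fst (\<phi> t) \<le> -1) at_top"
      using eventually_ge_at_top[of 0] by (rule eventually_mono[rotated])
    with tendsto_fst[OF lim] have "a / 5 \<le> -1"
      using tendsto_upperbound[of "\<lambda>t. fst (\<phi> t)" "a / 5" at_top "-1"] by simp
    with \<open>a > 0\<close> show False by simp
  qed
qed

end
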